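(* Fix a tree partition of $\omega$ and let $k,\ell\ge2$. There is a radial reduction of $\mathcal G_k$ to $\mathcal G_\ell$ if and only if $k\ge\ell$.
   Context: A tree partition of $\omega$ is a family $\langle A_s:s\in\omega^{<\omega}\rangle$ of infinite subsets of $\omega$ such that $A_\varnothing=\omega$, for each $s$ the family $\{A_{s^\frown n}:n\in\omega\}$ is a partition of $A_s$, and any two distinct points of $\omega$ lie in different cells $A_s\neq A_t$ with $|s|=|t|=n$ for some $n$. For $x\in\omega$, $b_x\in\omega^\omega$ is the unique branch with $x\in A_{b_x\upharpoonright n}$ for all $n$; $x\mapsto b_x$ is injective; put $B=\{b_x:x\in\omega\}$. For $p\ne q$ in $\omega^\omega$, $\Delta(p,q)=\min\{n:p(n)\ne q(n)\}$, and $\Delta(x,y)=\Delta(b_x,b_y)$ for $x\neq y$ in $\omega$. For $k\ge2$, $c_k(\{x,y\})=\Delta(x,y)\bmod k$; a set $H\subseteq\omega$ is $c_k$-homogeneous if $c_k$ is constant on the pairs of elements of $H$; $\mathcal G_k$ is the ideal on $\omega$ generated by the $c_k$-homogeneous sets (and the finite sets). A radial reduction of $\mathcal G_k$ to $\mathcal G_\ell$ is an injection $F:B\to B$ for which there is a strictly increasing $h:\omega\to\omega$ with $\Delta(F(p),F(q))=h(\Delta(p,q))$ for all $p\ne q$ in $B$, and which witnesses $\mathcal G_k\le_K\mathcal G_\ell$, i.e. the induced map $f:\omega\to\omega$ given by $b_{f(x)}=F(b_x)$ satisfies $f^{-1}[A]\in\mathcal G_\ell$ for every $A\in\mathcal G_k$.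 *)

theory Defs
  imports "HOL.Hull" "HOL-Library.Disjoint_Sets"
begin

text \<open>Finite sequences are lists, and the one-step extension of \<open>s\<close> by \<open>n\<close> is \<open>s @ [n]\<close>.
  The partition of a cell is required to be disjoint as an indexed family, so different indices
  give different subcells.\<close>

definition tree_partition :: "(nat list \<Rightarrow> nat set) \<Rightarrow> bool" where
  "tree_partition A \<longleftrightarrow>
     (\<forall>s. infinite (A s)) \<and>
     A [] = UNIV \<and>
     (\<forall>s. disjoint_family (\<lambda>n. A (s @ [n])) \<and> (\<Union>n. A (s @ [n])) = A s) \<and>
     (\<forall>x y. x \<noteq> y \<longrightarrow>
        (\<exists>s t. length s = length t \<and> x \<in> A s \<and> y \<in> A t \<and> A s \<noteq> A t))"

definition restr :: "(nat \<Rightarrow> nat) \<Rightarrow> nat \<Rightarrow> nat list" where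
  "restr p n = map p [0..<n]"

definition branch :: "(nat list \<Rightarrow> nat set) \<Rightarrow> nat \<Rightarrow> (nat \<Rightarrow> nat)" where
  "branch A x = (THE p. \<forall>n. x \<in> A (restr p n))"

definition branches :: "(nat list \<Rightarrow> nat set) \<Rightarrow> (nat \<Rightarrow> nat) set" where
  "branches A = range (branch A)"

definition Delta :: "(nat \<Rightarrow> nat) \<Rightarrow> (nat \<Rightarrow> nat) \<Rightarrow> nat" where
  "Delta p q = (LEAST n. p n \<noteq> q n)"

text \<open>The colour of the pair \<open>{x, y}\<close>; it is symmetric and only meaningful for \<open>x \<noteq> y\<close>.\<close>

definition colour :: "(nat list \<Rightarrow> nat set) \<Rightarrow> nat \<Rightarrow> nat \<Rightarrow> nat \<Rightarrow> nat" where
  "colour A k x y = Delta (branch A x) (branch A y) mod k"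

definition homogeneous :: "(nat list \<Rightarrow> nat set) \<Rightarrow> nat \<Rightarrow> nat set \<Rightarrow> bool" where
  "homogeneous A k H \<longleftrightarrow> (\<exists>c. \<forall>x\<in>H. \<forall>y\<in>H. x \<noteq> y \<longrightarrow> colour A k x y = c)"

text \<open>Properness is not part of the definition of an ideal.\<close>

definition set_ideal :: "'a set set \<Rightarrow> bool" where
  "set_ideal I \<longleftrightarrow>
     {} \<in> I \<and> (\<forall>X\<in>I. \<forall>Y. Y \<subseteq> X \<longrightarrow> Y \<in> I) \<and> (\<forall>X\<in>I. \<forall>Y\<in>I. X \<union> Y \<in> I)"

definition G_ideal :: "(nat list \<Rightarrow> nat set) \<Rightarrow> nat \<Rightarrow> nat set set" where
  "G_ideal A k = set_ideal hull ({H. homogeneous A k H} \<union> {H. finite H})"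

definition katetov_witness :: "('b \<Rightarrow> 'a) \<Rightarrow> 'a set set \<Rightarrow> 'b set set \<Rightarrow> bool" where
  "katetov_witness f I J \<longleftrightarrow> (\<forall>X\<in>I. f -` X \<in> J)"

definition induced_map ::
    "(nat list \<Rightarrow> nat set) \<Rightarrow> ((nat \<Rightarrow> nat) \<Rightarrow> (nat \<Rightarrow> nat)) \<Rightarrow> nat \<Rightarrow> nat" where
  "induced_map A F x = (THE y. branch A y = F (branch A x))"

text \<open>Only the values of \<open>F\<close> on \<open>branches A\<close> matter.\<close>

definition radial_reduction ::
    "(nat list \<Rightarrow> nat set) \<Rightarrow> nat \<Rightarrow> nat \<Rightarrow> ((nat \<Rightarrow> nat) \<Rightarrow> (nat \<Rightarrow> nat)) \<Rightarrow> bool" where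
  "radial_reduction A k l F \<longleftrightarrow>
     F ` branches A \<subseteq> branches A \<and>
     inj_on F (branches A) \<and>
     (\<exists>h::nat \<Rightarrow> nat. strict_mono h \<and>
        (\<forall>p\<in>branches A. \<forall>q\<in>branches A. p \<noteq> q \<longrightarrow> Delta (F p) (F q) = h (Delta p q))) \<and>
     katetov_witness (induced_map A F) (G_ideal A k) (G_ideal A l)"

lemma restr_Suc: "restr p (Suc n) = restr p n @ [p n]"
  by (simp add: restr_def)

lemma tree_partition_ex1_branch:
  assumes A: "tree_partition A"
  shows "\<exists>!p. \<forall>n. x \<in> A (restr p n)"
proof -
  have un: "(\<Union>n. A (s @ [n])) = A s" for s
    using A by (simp add: tree_partition_def)
  have dj: "m = n" if "x \<in> A (s @ [m])" "x \<in> A (s @ [n])" for s m n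
  proof (rule ccontr)
    assume "m \<noteq> n"
    moreover have "disjoint_family (\<lambda>n. A (s @ [n]))"
      using A by (simp add: tree_partition_def)
    ultimately have "A (s @ [m]) \<inter> A (s @ [n]) = {}"
      by (simp add: disjoint_family_on_def)
    then show False using that by blast
  qed
  define S where "S = rec_nat [] (\<lambda>_ s. s @ [SOME n. x \<in> A (s @ [n])])"
  have S0: "S 0 = []"
    by (simp add: S_def)
  have SS: "S (Suc n) = S n @ [SOME m. x \<in> A (S n @ [m])]" for n
    by (simp add: S_def)
  have xS: "x \<in> A (S n)" for n
  proof (induction n)
    case 0
    then show ?case using A by (simp add: S0 tree_partition_def)
  next
    case (Suc n)
    then have "\<exists>m. x \<in> A (S n @ [m])" using un[of "S n"] by blast
    then show ?case unfolding SS by (rule someI_ex)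
  qed
  define p where "p n = (SOME m. x \<in> A (S n @ [m]))" for n
  have r: "restr p n = S n" for n
  proof (induction n)
    case 0
    show ?case by (simp add: restr_def S0)
  next
    case (Suc n)
    then show ?case by (simp only: restr_Suc SS p_def)
  qed
  show ?thesis
  proof (rule ex1I[of _ p])
    show "\<forall>n. x \<in> A (restr p n)" by (simp add: r xS)
  next
    fix q assume q: "\<forall>n. x \<in> A (restr q n)"
    have e: "restr q n = S n" for n
    proof (induction n)
      case 0
      then show ?case by (simp add: restr_def S0)
    next
      case (Suc n)
      have "x \<in> A (S n @ [q n])" using q[rule_format, of "Suc n"] Suc by (simp add: restr_Suc)
      moreover have "x \<in> A (S n @ [p n])" using xS[of "Suc n"] by (simp add: SS p_def)
      ultimately show ?case using dj Suc by (simp add: restr_Suc SS p_def)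
    qed
    have "q n = p n" for n
      using e[of "Suc n"] r[of "Suc n"] unfolding restr_Suc by (metis last_snoc)
    then show "q = p" by auto
  qed
qed

lemma branch_mem:
  assumes "tree_partition A"
  shows "x \<in> A (restr (branch A x) n)"
  using theI'[OF tree_partition_ex1_branch[OF assms, of x]] by (simp add: branch_def)

lemma tree_partition_level_unique:
  assumes "tree_partition A" "x \<in> A s" "x \<in> A t" "length s = length t"
  shows "s = t"
  using assms(4,2,3)
proof (induction s arbitrary: t rule: rev_induct)
  case Nil
  then show ?case by simp
next
  case (snoc m s)
  then obtain t' n where t: "t = t' @ [n]" "length t' = length s"
    by (cases t rule: rev_cases) auto
  have sub: "A (u @ [i]) \<subseteq> A u" for u i
  proof -
    have "(\<Union>n. A (u @ [n])) = A u" using assms(1) by (simp add: tree_partition_def)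
    then show ?thesis by blast
  qed
  have "x \<in> A s" "x \<in> A t'"
    using snoc.prems sub t(1) by blast+
  then have "s = t'" using snoc.IH t(2) by simp
  moreover have "m = n"
  proof (rule ccontr)
    assume "m \<noteq> n"
    moreover have "disjoint_family (\<lambda>n. A (s @ [n]))"
      using assms(1) by (simp add: tree_partition_def)
    ultimately have "A (s @ [m]) \<inter> A (s @ [n]) = {}"
      by (simp add: disjoint_family_on_def)
    then show False using snoc.prems(2,3) t(1) \<open>s = t'\<close> by blast
  qed
  ultimately show ?case using t by simp
qed

lemma inj_branch:
  assumes "tree_partition A"
  shows "inj (branch A)"
proof (rule injI, rule ccontr)
  fix x y assume e: "branch A x = branch A y" and "x \<noteq> y"
  then obtain s t where st: "length s = length t" "x \<in> A s" "y \<in> A t" "A s \<noteq> A t"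
    using assms unfolding tree_partition_def by blast
  have len: "length (restr p n) = n" for p n by (simp add: restr_def)
  have "s = restr (branch A x) (length s)"
    by (rule tree_partition_level_unique[OF assms st(2) branch_mem[OF assms]]) (simp add: len)
  moreover have "t = restr (branch A y) (length s)"
    by (rule tree_partition_level_unique[OF assms st(3) branch_mem[OF assms]]) (simp add: len st)
  ultimately have "s = t" unfolding e by (rule trans[OF _ sym])
  then show False using st(4) by simp
qed

end

theory Submission
  imports Defs
begin

text \<open>
  A radial map changes colours only through its level function \<open>h\<close>, so everything depends on the
  residues of \<open>h\<close>.

  If \<open>l \<le> k\<close>, there is room for all residues modulo \<open>l\<close> among those modulo \<open>k\<close>: the function
  \<open>h n = k * n + n mod l\<close> is strictly increasing and satisfies \<open>h n mod k = n mod l\<close>.  A map with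
  this level function pulls \<open>k\<close>-homogeneous sets back to \<open>l\<close>-homogeneous ones, and injectivity takes
  care of finite sets.  Such a map exists because every strictly increasing \<open>h\<close> is the level
  function of some radial self-map of the branches (\<open>ex_radial_map\<close>): the branches are countable and
  dense in Baire space, and every node has infinitely many children, so the images can be chosen
  one point at a time.

  If \<open>k < l\<close>, the pigeonhole principle gives levels \<open>a < b < l\<close> with \<open>h a\<close> and \<open>h b\<close> congruent modulo
  \<open>k\<close>.  Take a set of points that branches infinitely at level \<open>a\<close>, each part of which branches
  infinitely again at level \<open>b\<close>, with no other branching (\<open>ex_two_level_fan\<close>).  Its image is
  \<open>k\<close>-homogeneous.  But \<open>a\<close> and \<open>b\<close> have different residues modulo \<open>l\<close>, and finitely many
  \<open>l\<close>-homogeneous sets cannot cover the fan (\<open>two_level_fan_not_in_G_ideal\<close>), so the map is not a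
  Katetov witness.
\<close>

section \<open>Branches and their splitting levels\<close>

lemma Delta_eqI:
  assumes "\<And>m. m < n \<Longrightarrow> p m = q m" "p n \<noteq> q n"
  shows "Delta p q = n"
  unfolding Delta_def using assms by (intro Least_equality) (auto intro: leI)

lemma Delta_differ: "p \<noteq> q \<Longrightarrow> p (Delta p q) \<noteq> q (Delta p q)"
  unfolding Delta_def by (rule LeastI_ex) auto

lemma Delta_agree: "m < Delta p q \<Longrightarrow> p m = q m"
  unfolding Delta_def using not_less_Least by blast

lemma Delta_commute: "Delta p q = Delta q p"
  unfolding Delta_def by (rule arg_cong[where f = Least]) auto

lemma Delta_geI:
  assumes "p \<noteq> q" "\<And>m. m < n \<Longrightarrow> p m = q m"
  shows "n \<le> Delta p q"
  using Delta_differ[OF assms(1)] assms(2) by (metis not_less)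

lemma branch_eq_iff: "tree_partition A \<Longrightarrow> branch A x = branch A y \<longleftrightarrow> x = y"
  using inj_branch by (auto dest: injD)

text \<open>Density of the set of branches: every cell is nonempty.\<close>

lemma ex_branch_extending:
  assumes A: "tree_partition A"
  shows "\<exists>x. \<forall>m<n. branch A x m = p m"
proof -
  have "infinite (A (restr p n))"
    using A by (simp add: tree_partition_def)
  then obtain x where x: "x \<in> A (restr p n)"
    by (metis finite.emptyI ex_in_conv)
  have "restr (branch A x) n = restr p n"
    by (rule tree_partition_level_unique[OF A branch_mem[OF A] x]) (simp add: restr_def)
  then show ?thesis
    by (intro exI[of _ x]) (auto simp: restr_def)
qed

section \<open>Radial maps with a prescribed level function\<close>

text \<open>The points are treated in their order as natural numbers.  The position of a new point \<open>x\<close>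
  relative to its predecessors is determined by a predecessor \<open>i\<close> from which it splits last, at level
  \<open>d\<close> say.  Its image follows the image of \<open>i\<close> below level \<open>h d\<close> and takes a fresh value there.\<close>

lemma ex_radial_map:
  fixes h :: "nat \<Rightarrow> nat"
  assumes A: "tree_partition A" and h: "strict_mono h"
  shows "\<exists>f. inj f \<and> (\<forall>x y. x \<noteq> y \<longrightarrow>
           Delta (branch A (f x)) (branch A (f y)) = h (Delta (branch A x) (branch A y)))"
proof -
  let ?b = "branch A"
  define P :: "(nat \<Rightarrow> nat) \<Rightarrow> nat \<Rightarrow> nat \<Rightarrow> bool" where
    "P f x r \<longleftrightarrow> (\<forall>y<x. r \<noteq> f y \<and> Delta (?b r) (?b (f y)) = h (Delta (?b x) (?b y)))" for f x r
  have "\<exists>f. \<forall>x. P f x (f x)"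
  proof (rule dependent_wellorder_choice)
    fix x f assume IH: "\<And>y. y < x \<Longrightarrow> P f y (f y)"
    have IH': "f y \<noteq> f z \<and> Delta (?b (f y)) (?b (f z)) = h (Delta (?b y) (?b z))"
      if "y < x" "z < x" "y \<noteq> z" for y z
      using IH[of y] IH[of z] that unfolding P_def
      by (metis Delta_commute nat_neq_iff)
    show "\<exists>r. P f x r"
    proof (cases "x = 0")
      case True
      then show ?thesis by (simp add: P_def)
    next
      case False
      define d where "d = Max ((\<lambda>y. Delta (?b x) (?b y)) ` {..<x})"
      have "d \<in> (\<lambda>y. Delta (?b x) (?b y)) ` {..<x}"
        unfolding d_def using False by (intro Max_in) auto
      then obtain i where i: "i < x" "Delta (?b x) (?b i) = d"
        by auto
      have le_d: "Delta (?b x) (?b j) \<le> d" if "j < x" for j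
        unfolding d_def using that by (intro Max_ge) auto
      obtain v where v: "v \<notin> (\<lambda>j. ?b (f j) (h d)) ` {..<x}"
        using ex_new_if_finite[of "(\<lambda>j. ?b (f j) (h d)) ` {..<x}"] by auto
      obtain r where "\<forall>m<Suc (h d). ?b r m = ((?b (f i))(h d := v)) m"
        using ex_branch_extending[OF A] by blast
      then have rv: "?b r (h d) = v" and r: "\<And>m. m < h d \<Longrightarrow> ?b r m = ?b (f i) m"
        by auto
      have "r \<noteq> f j \<and> Delta (?b r) (?b (f j)) = h (Delta (?b x) (?b j))" if j: "j < x" for j
      proof
        show "r \<noteq> f j"
          using v rv j by auto
        define e where "e = Delta (?b x) (?b j)"
        have e_d: "e \<le> d"
          using le_d[OF j] by (simp add: e_def)
        then have he: "h e \<le> h d"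
          using h by (simp add: strict_mono_less_eq)
        have x_j: "?b x \<noteq> ?b j" and x_i: "?b x \<noteq> ?b i"
          using branch_eq_iff[OF A] i j by auto
        \<comment> \<open>By maximality of \<open>d\<close>, the points \<open>i\<close> and \<open>j\<close> agree as long as \<open>x\<close> and \<open>j\<close> do.\<close>
        have agree: "?b (f i) m = ?b (f j) m" if m: "m < h e" for m
        proof (cases "i = j")
          case False
          have "e \<le> Delta (?b i) (?b j)"
          proof (rule Delta_geI)
            show "?b i \<noteq> ?b j" using False branch_eq_iff[OF A] by simp
            show "?b i n = ?b j n" if "n < e" for n
              using Delta_agree[of n "?b x" "?b i"] Delta_agree[of n "?b x" "?b j"] that e_d i
              by (simp add: e_def)
          qed
          then have "m < h (Delta (?b i) (?b j))"
            using m h by (meson less_le_trans strict_mono_less_eq)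
          then show ?thesis
            using IH'[OF i(1) j False] by (simp add: Delta_agree)
        qed simp
        have differ: "?b r (h e) \<noteq> ?b (f j) (h e)"
          \<comment> \<open>At \<open>e = d\<close> the fresh value separates; below it \<open>x\<close> still follows \<open>i\<close>, so \<open>i\<close> and \<open>j\<close>
            split at \<open>e\<close> as well and their images do so at \<open>h e\<close>.\<close>
        proof (cases "e = d")
          case True
          then show ?thesis using rv v j by auto
        next
          case False
          with e_d have ed: "e < d" by simp
          then have ij: "i \<noteq> j" using i by (auto simp: e_def)
          have "Delta (?b i) (?b j) = e"
          proof (rule Delta_eqI)
            show "?b i n = ?b j n" if "n < e" for n
              using Delta_agree[of n "?b x" "?b i"] Delta_agree[of n "?b x" "?b j"] that ed i
              by (simp add: e_def)
            show "?b i e \<noteq> ?b j e"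
              using Delta_agree[of e "?b x" "?b i"] Delta_differ[OF x_j] ed i
              by (simp add: e_def)
          qed
          then have "Delta (?b (f i)) (?b (f j)) = h e" "f i \<noteq> f j"
            using IH'[OF i(1) j ij] by auto
          then have "?b (f i) (h e) \<noteq> ?b (f j) (h e)"
            using Delta_differ branch_eq_iff[OF A] by metis
          moreover have "h e < h d"
            using ed h by (simp add: strict_mono_less)
          ultimately show ?thesis using r by simp
        qed
        have "Delta (?b r) (?b (f j)) = h e"
          using agree differ r he by (intro Delta_eqI) auto
        then show "Delta (?b r) (?b (f j)) = h (Delta (?b x) (?b j))"
          by (simp add: e_def)
      qed
      then show ?thesis unfolding P_def by blast
    qed
  qed (simp add: P_def)
  then obtain f where f: "\<And>x y. y < x \<Longrightarrow>
      f x \<noteq> f y \<and> Delta (?b (f x)) (?b (f y)) = h (Delta (?b x) (?b y))"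
    unfolding P_def by blast
  have "f x \<noteq> f y \<and> Delta (?b (f x)) (?b (f y)) = h (Delta (?b x) (?b y))" if "x \<noteq> y" for x y
    using f[of x y] f[of y x] that by (metis Delta_commute nat_neq_iff)
  then show ?thesis
    unfolding inj_def by blast
qed

section \<open>The ideals\<close>

lemma set_ideal_G_ideal: "set_ideal (G_ideal A k)"
  unfolding G_ideal_def
proof (rule hull_in)
  fix \<I> :: "nat set set set"
  assume "Ball \<I> set_ideal"
  then have *: "\<And>I. I \<in> \<I> \<Longrightarrow> set_ideal I" by blast
  show "set_ideal (\<Inter>\<I>)"
    unfolding set_ideal_def
  proof (intro conjI ballI allI impI)
    show "{} \<in> \<Inter>\<I>" using * by (auto simp: set_ideal_def)
    show "Y \<in> \<Inter>\<I>" if "X \<in> \<Inter>\<I>" "Y \<subseteq> X" for X Y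
      using * that unfolding set_ideal_def by (meson InterE InterI)
    show "X \<union> Y \<in> \<Inter>\<I>" if "X \<in> \<Inter>\<I>" "Y \<in> \<Inter>\<I>" for X Y
      using * that unfolding set_ideal_def by (meson InterE InterI)
  qed
qed

lemma homogeneous_in_G_ideal: "homogeneous A k H \<Longrightarrow> H \<in> G_ideal A k"
  unfolding G_ideal_def by (rule hull_inc) simp

lemma finite_in_G_ideal: "finite H \<Longrightarrow> H \<in> G_ideal A k"
  unfolding G_ideal_def by (rule hull_inc) simp

lemma G_ideal_subset:
  assumes "set_ideal I" "\<And>H. homogeneous A k H \<Longrightarrow> H \<in> I" "\<And>H. finite H \<Longrightarrow> H \<in> I"
  shows "G_ideal A k \<subseteq> I"
  unfolding G_ideal_def using assms by (intro hull_minimal) auto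

text \<open>Singletons are homogeneous, so homogeneous sets alone already suffice for the covering.\<close>

lemma G_ideal_finite_cover:
  assumes "X \<in> G_ideal A k"
  shows "\<exists>\<H>. finite \<H> \<and> (\<forall>H\<in>\<H>. homogeneous A k H) \<and> X \<subseteq> \<Union>\<H>"
proof -
  define covered where
    "covered X \<longleftrightarrow> (\<exists>\<H>. finite \<H> \<and> (\<forall>H\<in>\<H>. homogeneous A k H) \<and> X \<subseteq> \<Union>\<H>)" for X
  have coveredI: "covered X"
    if "finite \<H>" "\<forall>H\<in>\<H>. homogeneous A k H" "X \<subseteq> \<Union>\<H>" for X \<H>
    using that covered_def by metis
  have "G_ideal A k \<subseteq> Collect covered"
  proof (rule G_ideal_subset)
    have "covered {}"
      by (rule coveredI[of "{}"]) auto
    moreover have "covered Y" if X: "covered X" and Y: "Y \<subseteq> X" for X Y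
    proof -
      obtain \<H> where "finite \<H>" "\<forall>H\<in>\<H>. homogeneous A k H" "X \<subseteq> \<Union>\<H>"
        using X covered_def by metis
      then show ?thesis
        using Y by (intro coveredI[of \<H>]) auto
    qed
    moreover have "covered (X \<union> Y)" if X: "covered X" and Y: "covered Y" for X Y
    proof -
      obtain \<H> where "finite \<H>" "\<forall>H\<in>\<H>. homogeneous A k H" "X \<subseteq> \<Union>\<H>"
        using X covered_def by metis
      moreover obtain \<K> where "finite \<K>" "\<forall>H\<in>\<K>. homogeneous A k H" "Y \<subseteq> \<Union>\<K>"
        using Y covered_def by metis
      ultimately show ?thesis
        by (intro coveredI[of "\<H> \<union> \<K>"]) auto
    qed
    ultimately show "set_ideal (Collect covered)"
      by (simp add: set_ideal_def)
    show "H \<in> Collect covered" if "homogeneous A k H" for H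
      using that coveredI[of "{H}" H] by simp
    show "H \<in> Collect covered" if "finite H" for H
      using that coveredI[of "(\<lambda>x. {x}) ` H" H] by (simp add: homogeneous_def)
  qed
  with assms have "covered X"
    by blast
  then show ?thesis
    by (simp add: covered_def)
qed

text \<open>The sets with preimage in an ideal form an ideal, so only generators have to be tested.\<close>

lemma katetov_witness_G_idealI:
  assumes "inj f" and hom: "\<And>H. homogeneous A k H \<Longrightarrow> homogeneous A l (f -` H)"
  shows "katetov_witness f (G_ideal A k) (G_ideal A l)"
proof -
  have "G_ideal A k \<subseteq> {X. f -` X \<in> G_ideal A l}"
  proof (rule G_ideal_subset)
    show "set_ideal {X. f -` X \<in> G_ideal A l}"
      using set_ideal_G_ideal[of A l] unfolding set_ideal_def
      by (auto simp: vimage_Un) (meson vimage_mono)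
  qed (use assms in \<open>auto intro: homogeneous_in_G_ideal finite_in_G_ideal finite_vimageI\<close>)
  then show ?thesis
    by (auto simp: katetov_witness_def)
qed

section \<open>Fans splitting at two levels\<close>

text \<open>The double indexing by \<open>i\<close> and \<open>j\<close> records the values of a branch at the two levels.\<close>

lemma ex_two_level_fan:
  assumes A: "tree_partition A" and "a < b"
  shows "\<exists>x :: nat \<Rightarrow> nat \<Rightarrow> nat.
    (\<forall>i i' j j'. i \<noteq> i' \<longrightarrow> x i j \<noteq> x i' j' \<and> Delta (branch A (x i j)) (branch A (x i' j')) = a) \<and>
    (\<forall>i j j'. j \<noteq> j' \<longrightarrow> x i j \<noteq> x i j' \<and> Delta (branch A (x i j)) (branch A (x i j')) = b)"
proof -
  let ?p = "\<lambda>i j m. if m = a then i else if m = b then j else 0 :: nat"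
  define x where "x i j = (SOME y. \<forall>m<Suc b. branch A y m = ?p i j m)" for i j
  have x: "branch A (x i j) m = ?p i j m" if "m \<le> b" for i j m
    using someI_ex[OF ex_branch_extending[OF A, of "Suc b" "?p i j"]] that
    unfolding x_def by (simp add: less_Suc_eq_le)
  show ?thesis
  proof (intro exI[of _ x] conjI allI impI)
    fix i i' j j' :: nat assume ne: "i \<noteq> i'"
    show "x i j \<noteq> x i' j'"
      using x[of a i j] x[of a i' j'] ne \<open>a < b\<close> by auto
    show "Delta (branch A (x i j)) (branch A (x i' j')) = a"
      using x ne \<open>a < b\<close> by (intro Delta_eqI) auto
  next
    fix i j j' :: nat assume ne: "j \<noteq> j'"
    show "x i j \<noteq> x i j'"
      using x[of b i j] x[of b i j'] ne \<open>a < b\<close> by auto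
    show "Delta (branch A (x i j)) (branch A (x i j')) = b"
      using x ne \<open>a < b\<close> by (intro Delta_eqI) auto
  qed
qed

lemma finite_if_all_equal:
  assumes "\<And>u v. u \<in> S \<Longrightarrow> v \<in> S \<Longrightarrow> u = v"
  shows "finite S"
proof (cases "S = {}")
  case False
  then obtain u where "u \<in> S" by blast
  then have "S \<subseteq> {u}" using assms by blast
  then show ?thesis by (rule finite_subset) simp
qed simp

text \<open>A homogeneous set whose colour differs from that of the upper level meets at most one first-level
  part of the fan; otherwise its colour differs from that of the lower level, and it meets each part
  in at most one point.  So some part avoids all members of a finite cover that are of the first
  kind, and some point of that part avoids all those of the second kind.\<close>

lemma two_level_fan_not_in_G_ideal:
  fixes x :: "nat \<Rightarrow> nat \<Rightarrow> nat"
  assumes xa: "\<And>i i' j j'. i \<noteq> i' \<Longrightarrow>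
      x i j \<noteq> x i' j' \<and> Delta (branch A (x i j)) (branch A (x i' j')) = a"
    and xb: "\<And>i j j'. j \<noteq> j' \<Longrightarrow>
      x i j \<noteq> x i j' \<and> Delta (branch A (x i j)) (branch A (x i j')) = b"
    and ab: "a mod l \<noteq> b mod l"
  shows "(\<Union>i. range (x i)) \<notin> G_ideal A l"
proof
  assume "(\<Union>i. range (x i)) \<in> G_ideal A l"
  then obtain \<H> where fin: "finite \<H>" and hom: "\<forall>H\<in>\<H>. homogeneous A l H"
    and cover: "(\<Union>i. range (x i)) \<subseteq> \<Union>\<H>"
    using G_ideal_finite_cover[of _ A l] by metis
  obtain c where "\<forall>H\<in>\<H>. \<forall>y\<in>H. \<forall>z\<in>H. y \<noteq> z \<longrightarrow> colour A l y z = c H"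
    using bchoice[OF hom[unfolded homogeneous_def]] by (rule exE)
  then have c: "colour A l y z = c H" if "H \<in> \<H>" "y \<in> H" "z \<in> H" "y \<noteq> z" for H y z
    using that by simp
  have "finite {i. \<exists>j. x i j \<in> H}" if "H \<in> \<H>" "c H \<noteq> a mod l" for H
  proof (rule finite_if_all_equal)
    fix i i' assume "i \<in> {i. \<exists>j. x i j \<in> H}" "i' \<in> {i. \<exists>j. x i j \<in> H}"
    then obtain j j' where "x i j \<in> H" "x i' j' \<in> H" by auto
    then show "i = i'"
      using c[OF that(1), of "x i j" "x i' j'"] xa[of i i' j j'] that(2)
      by (cases "i = i'") (auto simp: colour_def)
  qed
  then have "finite (\<Union>H \<in> {H \<in> \<H>. c H \<noteq> a mod l}. {i. \<exists>j. x i j \<in> H})"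
    using fin by auto
  then obtain i where "i \<notin> (\<Union>H \<in> {H \<in> \<H>. c H \<noteq> a mod l}. {i. \<exists>j. x i j \<in> H})"
    by (rule exE[OF ex_new_if_finite[OF infinite_UNIV_nat]])
  then have i: "c H = a mod l" if "H \<in> \<H>" "x i j \<in> H" for H j
    using that by blast
  have "finite {j. x i j \<in> H}" if "H \<in> \<H>" for H
  proof (rule finite_if_all_equal)
    fix j j' assume "j \<in> {j. x i j \<in> H}" "j' \<in> {j. x i j \<in> H}"
    then show "j = j'"
      using c[OF that, of "x i j" "x i j'"] xb[of j j' i] i[OF that] ab
      by (cases "j = j'") (auto simp: colour_def)
  qed
  then have "finite (\<Union>H \<in> \<H>. {j. x i j \<in> H})"
    using fin by auto
  then obtain j where "j \<notin> (\<Union>H \<in> \<H>. {j. x i j \<in> H})"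
    by (rule exE[OF ex_new_if_finite[OF infinite_UNIV_nat]])
  then show False
    using cover by blast
qed

section \<open>Radial reductions\<close>

lemma branch_induced_map:
  assumes A: "tree_partition A" and F: "F ` branches A \<subseteq> branches A"
  shows "branch A (induced_map A F x) = F (branch A x)"
proof -
  have "F (branch A x) \<in> range (branch A)"
    using F by (auto simp: branches_def)
  then have "\<exists>!y. branch A y = F (branch A x)"
    using branch_eq_iff[OF A] by (metis imageE)
  then show ?thesis
    unfolding induced_map_def by (rule theI')
qed

lemma ex_radial_reduction:
  assumes A: "tree_partition A" and l: "l > 0" and kl: "l \<le> k"
  shows "\<exists>F. radial_reduction A k l F"
proof -
  define h where "h n = k * n + n mod l" for n
  have mod_less: "n mod l < k" for n
    using l kl mod_less_divisor[of l n] by linarith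
  have h: "strict_mono h"
  proof (rule strict_mono_Suc_iff[THEN iffD2, rule_format])
    show "h n < h (Suc n)" for n
      using mod_less[of n] by (simp add: h_def)
  qed
  have hmod: "h n mod k = n mod l" for n
    using mod_less[of n] by (simp add: h_def)
  obtain f where inj: "inj f" and f: "\<And>x y. x \<noteq> y \<Longrightarrow>
      Delta (branch A (f x)) (branch A (f y)) = h (Delta (branch A x) (branch A y))"
    using ex_radial_map[OF A h] by blast
  define F where "F = branch A \<circ> f \<circ> inv (branch A)"
  have F: "F (branch A x) = branch A (f x)" for x
    using inj_branch[OF A] by (simp add: F_def)
  have maps: "F ` branches A \<subseteq> branches A"
    by (auto simp: branches_def F)
  have ind: "induced_map A F = f"
    using branch_induced_map[OF A maps] branch_eq_iff[OF A] by (auto simp: F)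
  have "radial_reduction A k l F"
    unfolding radial_reduction_def ind
  proof (intro conjI exI[of _ h])
    show "inj_on F (branches A)"
      using inj by (auto simp: branches_def inj_on_def F branch_eq_iff[OF A])
    show "\<forall>p\<in>branches A. \<forall>q\<in>branches A. p \<noteq> q \<longrightarrow> Delta (F p) (F q) = h (Delta p q)"
    proof (unfold branches_def, intro ballI impI, elim imageE)
      fix p q x y assume "p \<noteq> q" "p = branch A x" "q = branch A y"
      then show "Delta (F p) (F q) = h (Delta p q)"
        using f[of x y] by (auto simp: F)
    qed
    show "katetov_witness f (G_ideal A k) (G_ideal A l)"
    proof (rule katetov_witness_G_idealI[OF inj])
      have col: "colour A l x y = colour A k (f x) (f y)" if "x \<noteq> y" for x y
        using f[OF that] by (simp add: colour_def hmod)
      show "homogeneous A l (f -` H)" if "homogeneous A k H" for H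
        using that inj col unfolding homogeneous_def by (metis injD vimageE)
    qed
  qed (use maps h in auto)
  then show ?thesis by blast
qed

lemma radial_reduction_imp_le:
  assumes A: "tree_partition A" and k: "k > 0" and red: "radial_reduction A k l F"
  shows "l \<le> k"
proof (rule ccontr)
  assume "\<not> l \<le> k"
  then have kl: "k < l" by simp
  obtain h where maps: "F ` branches A \<subseteq> branches A"
    and F: "\<And>p q. p \<in> branches A \<Longrightarrow> q \<in> branches A \<Longrightarrow> p \<noteq> q \<Longrightarrow> Delta (F p) (F q) = h (Delta p q)"
    and kat: "katetov_witness (induced_map A F) (G_ideal A k) (G_ideal A l)"
    using red unfolding radial_reduction_def by blast
  define f where "f = induced_map A F"
  have f: "Delta (branch A (f x)) (branch A (f y)) = h (Delta (branch A x) (branch A y))"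
    if "x \<noteq> y" for x y
    using F[of "branch A x" "branch A y"] that branch_eq_iff[OF A] branch_induced_map[OF A maps]
    by (simp add: f_def branches_def)
  have "(\<lambda>n. h n mod k) ` {..<l} \<subseteq> {..<k}"
    using k by auto
  then have "card ((\<lambda>n. h n mod k) ` {..<l}) \<le> k"
    using card_mono[of "{..<k}"] by fastforce
  then have "\<not> inj_on (\<lambda>n. h n mod k) {..<l}"
    using kl pigeonhole[of "\<lambda>n. h n mod k" "{..<l}"] by auto
  then obtain a b where ab: "a < b" "b < l" "h a mod k = h b mod k"
    unfolding inj_on_def by (metis lessThan_iff nat_neq_iff)
  obtain x :: "nat \<Rightarrow> nat \<Rightarrow> nat" where
    xa: "\<And>i i' j j'. i \<noteq> i' \<Longrightarrow>
      x i j \<noteq> x i' j' \<and> Delta (branch A (x i j)) (branch A (x i' j')) = a" and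
    xb: "\<And>i j j'. j \<noteq> j' \<Longrightarrow>
      x i j \<noteq> x i j' \<and> Delta (branch A (x i j)) (branch A (x i j')) = b"
    using ex_two_level_fan[OF A ab(1)] by blast
  define X where "X = (\<Union>i. range (x i))"
  have "colour A k (f y) (f z) = h a mod k" if "y \<in> X" "z \<in> X" "y \<noteq> z" for y z
  proof -
    obtain i j i' j' where yz: "y = x i j" "z = x i' j'"
      using \<open>y \<in> X\<close> \<open>z \<in> X\<close> unfolding X_def by blast
    have "Delta (branch A y) (branch A z) \<in> {a, b}"
      using xa[of i i' j j'] xb[of j j' i] yz \<open>y \<noteq> z\<close> by (cases "i = i'"; cases "j = j'") auto
    then show ?thesis
      using f[OF \<open>y \<noteq> z\<close>] ab(3) by (auto simp: colour_def)
  qed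
  then have "\<forall>u\<in>f ` X. \<forall>v\<in>f ` X. u \<noteq> v \<longrightarrow> colour A k u v = h a mod k"
    by auto
  then have "homogeneous A k (f ` X)"
    unfolding homogeneous_def by (rule exI)
  then have "f -` f ` X \<in> G_ideal A l"
    using kat homogeneous_in_G_ideal by (simp add: katetov_witness_def f_def)
  moreover have "X \<subseteq> f -` f ` X"
    by auto
  ultimately have "X \<in> G_ideal A l"
    using set_ideal_G_ideal[of A l] unfolding set_ideal_def by blast
  moreover have "a mod l \<noteq> b mod l"
    using ab by simp
  ultimately show False
    using two_level_fan_not_in_G_ideal[of x A a b l] xa xb by (simp add: X_def)
qed

theorem proposition6p6:
  fixes A :: "nat list \<Rightarrow> nat set" and k l :: nat
  assumes "tree_partition A" and "k \<ge> 2" and "l \<ge> 2"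
  shows "(\<exists>F. radial_reduction A k l F) \<longleftrightarrow> k \<ge> l"
  using radial_reduction_imp_le[OF assms(1)] ex_radial_reduction[OF assms(1)] assms(2,3) by auto

end
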